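(* Let $g:\mathbb{R}^4\to\mathbb{R}^4$ be defined by $$g(x_1,x_2,x_3,x_4)=\left(\frac{x_1^2-x_2^2}{\sqrt{x_1^2+x_2^2}},\frac{2x_1x_2}{\sqrt{x_1^2+x_2^2}},\frac{x_3^2-x_4^2}{\sqrt{x_3^2+x_4^2}},\frac{2x_3x_4}{\sqrt{x_3^2+x_4^2}}\right),$$ where for $i=1,3$, if $x_i=x_{i+1}=0$, the pair $\left(\frac{x_i^2-x_{i+1}^2}{\sqrt{x_i^2+x_{i+1}^2}},\frac{2x_ix_{i+1}}{\sqrt{x_i^2+x_{i+1}^2}}\right)$ is defined to be $(0,0)$. Then $$\hat{\alpha}(g,\bar z,g(\bar z))=1\quad\text{for any }\bar z=(\bar z_1,\bar z_2,\bar z_3,\bar z_4)\in\mathbb{R}^4\setminus\{\theta\}.$$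
   Context: $\theta$ denotes the origin; $\mathbb{R}^4$ has the Euclidean norm and inner product, and $\mathbb{B}(p,\eta)$ is the closed ball of center $p$ and radius $\eta$. Mordukhovich derivative: for $z,y\in\mathbb{R}^4$, $\widehat{D}^*g(z)(y)=\Big\{x\in\mathbb{R}^4:\limsup_{u\to z}\frac{\langle x,u-z\rangle-\langle y,g(u)-g(z)\rangle}{\|u-z\|+\|g(u)-g(z)\|}\le 0\Big\}$ ($g$ is continuous); this set may be empty. Covering constant: for $\bar w=g(\bar z)$, $$\hat{\alpha}(g,\bar z,\bar w)=\sup_{\eta>0}\inf\{\|x\|:x\in\widehat{D}^*g(z)(y),\ z\in\mathbb{B}(\bar z,\eta),\ g(z)\in\mathbb{B}(\bar w,\eta),\ \|y\|=1\}.$$ *)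

theory Defs
  imports "HOL-Analysis.Analysis"
begin

text \<open>
  \<^term>\<open>at z\<close> is the punctured neighbourhood filter, so the denominator of the quotient is positive.
  The upper limit is taken in the extended reals, since the library's \<^const>\<open>Limsup\<close> needs a
  complete lattice.
\<close>

definition mordukhovich_derivative ::
  "('a::real_inner \<Rightarrow> 'b::real_inner) \<Rightarrow> 'a \<Rightarrow> 'b \<Rightarrow> 'a set" where
  "mordukhovich_derivative g z y =
     {x. Limsup (at z) (\<lambda>u. ereal ((x \<bullet> (u - z) - y \<bullet> (g u - g z)) /
                                    (norm (u - z) + norm (g u - g z)))) \<le> 0}"

text \<open>
  Supremum and infimum are taken in the extended reals; in particular points \<^term>\<open>z\<close> and
  directions \<^term>\<open>y\<close> with empty derivative do not contribute, and the infimum of the empty set is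
  \<open>\<infinity>\<close>.
\<close>

definition covering_constant ::
  "('a::real_inner \<Rightarrow> 'b::real_inner) \<Rightarrow> 'a \<Rightarrow> 'b \<Rightarrow> ereal" where
  "covering_constant g zbar wbar =
     (SUP \<eta>\<in>{0::real<..}.
        Inf {ereal (norm x) | x y z.
               x \<in> mordukhovich_derivative g z y \<and>
               z \<in> cball zbar \<eta> \<and> g z \<in> cball wbar \<eta> \<and> norm y = 1})"

definition block :: "real \<Rightarrow> real \<Rightarrow> real \<times> real" where
  "block a b =
     (if a = 0 \<and> b = 0 then (0, 0)
      else ((a\<^sup>2 - b\<^sup>2) / sqrt (a\<^sup>2 + b\<^sup>2), 2 * a * b / sqrt (a\<^sup>2 + b\<^sup>2)))"

definition g_map :: "real ^ 4 \<Rightarrow> real ^ 4" where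
  "g_map x = vector [fst (block (x $ 1) (x $ 2)), snd (block (x $ 1) (x $ 2)),
                     fst (block (x $ 3) (x $ 4)), snd (block (x $ 3) (x $ 4))]"

lemma g_map_nth:
  "g_map x $ 1 = fst (block (x $ 1) (x $ 2))"
  "g_map x $ 2 = snd (block (x $ 1) (x $ 2))"
  "g_map x $ 3 = fst (block (x $ 3) (x $ 4))"
  "g_map x $ 4 = snd (block (x $ 3) (x $ 4))"
  by (simp_all add: g_map_def vector_def)

end

theory Submission
  imports Defs
begin

text \<open>
  In complex notation each block is \<open>f p = p\<^sup>2 / \<bar>p\<bar>\<close>, which preserves the norm and doubles the argument.
  Hence \<open>f p \<bullet> f q * N = 2 * D\<^sup>2 - N\<^sup>2\<close> with \<open>D = p \<bullet> q\<close> and \<open>N = \<bar>p\<bar> * \<bar>q\<bar>\<close>, so that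
  \<open>N * (D - f p \<bullet> f q) = (N - D) * (N + 2 * D)\<close>. This is nonnegative if \<open>D \<ge> 0\<close>: every \<open>w\<close> has a
  preimage \<open>q\<close> with \<open>\<bar>q - p\<bar> \<le> \<bar>w - f p\<bar>\<close>, and moving \<open>g z\<close> in the direction \<open>- y\<close> then forces
  \<open>\<bar>y\<bar> \<le> \<bar>x\<bar>\<close> for all \<open>x\<close> in the derivative at \<open>y\<close>. It is also at most \<open>3 * N * (N - D)\<close>,
  so \<open>D - f p \<bullet> f q\<close> is quadratically small near \<open>p\<close>; therefore \<open>z / \<bar>z\<bar>\<close> lies in the
  derivative at \<open>g z / \<bar>z\<bar>\<close>, even when one block of \<open>z\<close> vanishes.
\<close>

section \<open>Two general tests for the Mordukhovich derivative\<close>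

lemma norm_le_of_mem_mordukhovich_derivative:
  fixes g :: "'a::real_inner \<Rightarrow> 'b::real_inner"
  assumes cov: "\<And>w. \<exists>u. g u = w \<and> norm (u - z) \<le> norm (w - g z)"
    and x: "x \<in> mordukhovich_derivative g z y"
  shows "norm y \<le> norm x"
proof (cases "y = 0")
  case False
  show ?thesis
  proof (rule field_le_epsilon)
    fix e :: real
    assume "0 < e"
    define q where "q u = (x \<bullet> (u - z) - y \<bullet> (g u - g z)) / (norm (u - z) + norm (g u - g z))" for u
    have "Limsup (at z) (\<lambda>u. ereal (q u)) < ereal (e / 2)"
      using x \<open>0 < e\<close> unfolding mordukhovich_derivative_def q_def
      by (auto intro: le_less_trans)
    then have "eventually (\<lambda>u. ereal (q u) < ereal (e / 2)) (at z)"
      by (rule Limsup_lessD)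
    then obtain d where "d > 0" and d: "\<And>u. u \<noteq> z \<Longrightarrow> dist u z < d \<Longrightarrow> q u < e / 2"
      by (auto simp: eventually_at)
    \<comment> \<open>This choice keeps the preimage \<open>u\<close> of
      \<open>g z - t *\<^sub>R y\<close> within \<open>d / 2\<close> of \<open>z\<close>, where the
      bound on \<open>q\<close> applies.\<close>
    define t where "t = d / (2 * norm y)"
    have "t > 0" and ty: "t * norm y = d / 2"
      using \<open>d > 0\<close> False by (auto simp: t_def)
    obtain u where gu: "g u = g z - t *\<^sub>R y" and u: "norm (u - z) \<le> t * norm y"
      using cov[of "g z - t *\<^sub>R y"] \<open>t > 0\<close> by auto
    have "u \<noteq> z"
      using gu \<open>t > 0\<close> False by auto
    moreover have "dist u z < d"
      using u ty \<open>d > 0\<close> by (simp add: dist_norm)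
    ultimately have "q u < e / 2"
      by (rule d)
    moreover have "q u = (x \<bullet> (u - z) + t * (norm y)\<^sup>2) / (norm (u - z) + t * norm y)"
      using \<open>t > 0\<close> by (simp add: q_def gu power2_norm_eq_inner)
    moreover have "norm (u - z) + t * norm y > 0"
      using \<open>u \<noteq> z\<close> ty \<open>d > 0\<close> by (intro add_pos_pos) auto
    ultimately have "x \<bullet> (u - z) + t * (norm y)\<^sup>2 < e / 2 * (norm (u - z) + t * norm y)"
      by (simp add: pos_divide_less_eq)
    \<comment> \<open>The covering bound caps the denominator by twice \<open>t * norm y\<close>,
      which turns \<open>e / 2\<close> into \<open>e\<close>.\<close>
    also have "\<dots> \<le> e / 2 * (t * norm y + t * norm y)"
      using u \<open>0 < e\<close> by (intro mult_left_mono) auto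
    finally have "x \<bullet> (u - z) + t * (norm y)\<^sup>2 < e * (t * norm y)"
      by simp
    moreover have "- (x \<bullet> (u - z)) \<le> norm x * (t * norm y)"
      using norm_cauchy_schwarz[of "- x" "u - z"] mult_left_mono[OF u norm_ge_zero[of x]] by simp
    ultimately have "norm y * (t * norm y) \<le> (norm x + e) * (t * norm y)"
      by (simp add: power2_eq_square algebra_simps)
    then show "norm y \<le> norm x + e"
      using ty \<open>d > 0\<close> by simp
  qed
qed simp

text \<open>The denominator is at least \<open>norm (u - z)\<close>, so the quotient is at most
  \<open>C * norm (u - z)\<close>, which tends to 0.\<close>

lemma mem_mordukhovich_derivative_quadratic:
  fixes g :: "'a::real_inner \<Rightarrow> 'b::real_inner"
  assumes "C \<ge> 0"
    and le: "\<And>u. x \<bullet> (u - z) - y \<bullet> (g u - g z) \<le> C * (norm (u - z))\<^sup>2"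
  shows "x \<in> mordukhovich_derivative g z y"
\<comment> \<open>Over the trivial filter the upper limit is -\<infinity>; otherwise it is
  determined by the limit.\<close>
proof (cases "at z = bot")
  case False
  have "(x \<bullet> (u - z) - y \<bullet> (g u - g z)) / (norm (u - z) + norm (g u - g z)) \<le> C * norm (u - z)"
    if "u \<noteq> z" for u
  proof -
    have pos: "norm (u - z) + norm (g u - g z) > 0"
      using that by (intro add_pos_nonneg) auto
    have "x \<bullet> (u - z) - y \<bullet> (g u - g z) \<le> C * norm (u - z) * norm (u - z)"
      using le[of u] by (simp add: power2_eq_square mult.assoc)
    also have "\<dots> \<le> C * norm (u - z) * (norm (u - z) + norm (g u - g z))"
      using \<open>C \<ge> 0\<close> by (intro mult_left_mono) auto
    finally show ?thesis
      using pos by (simp add: pos_divide_le_eq)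
  qed
  then have "Limsup (at z) (\<lambda>u. ereal ((x \<bullet> (u - z) - y \<bullet> (g u - g z)) /
      (norm (u - z) + norm (g u - g z)))) \<le> Limsup (at z) (\<lambda>u. ereal (C * norm (u - z)))"
    by (intro Limsup_mono) (auto simp: eventually_at_filter)
  also have "((\<lambda>u. C * norm (u - z)) \<longlongrightarrow> C * norm (z - z)) (at z)"
    by (intro tendsto_intros)
  then have "Limsup (at z) (\<lambda>u. ereal (C * norm (u - z))) = ereal 0"
    using False by (intro lim_imp_Limsup) auto
  finally show ?thesis
    by (simp add: mordukhovich_derivative_def zero_ereal_def)
qed (simp add: mordukhovich_derivative_def)

section \<open>The angle-doubling map of the plane\<close>

definition block_map :: "real \<times> real \<Rightarrow> real \<times> real" where
  "block_map p = block (fst p) (snd p)"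

text \<open>This is cos 2t = 2 cos^2 t - 1 for the angle t between \<open>p\<close> and
  \<open>q\<close>, cleared of denominators so that zero vectors are allowed.\<close>

lemma inner_block_map:
  "block_map p \<bullet> block_map q * (norm p * norm q) = 2 * (p \<bullet> q)\<^sup>2 - (norm p * norm q)\<^sup>2"
proof (cases "p = 0 \<or> q = 0")
  case False
  obtain a b c d where pq: "p = (a, b)" "q = (c, d)"
    by fastforce
  have "norm p \<noteq> 0" "norm q \<noteq> 0"
    using False by auto
  moreover have "block_map p = ((a\<^sup>2 - b\<^sup>2) / norm p, 2 * a * b / norm p)"
    "block_map q = ((c\<^sup>2 - d\<^sup>2) / norm q, 2 * c * d / norm q)"
    using False by (auto simp: pq block_map_def block_def norm_prod_def zero_prod_def)
  ultimately have "block_map p \<bullet> block_map q * (norm p * norm q)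
      = (a\<^sup>2 - b\<^sup>2) * (c\<^sup>2 - d\<^sup>2) + 4 * a * b * c * d"
    by (simp add: field_simps)
  moreover have "(norm p * norm q)\<^sup>2 = (a\<^sup>2 + b\<^sup>2) * (c\<^sup>2 + d\<^sup>2)"
    by (simp add: pq norm_prod_def power_mult_distrib)
  ultimately show ?thesis
    by (simp add: pq power2_eq_square algebra_simps)
qed auto

lemma norm_block_map [simp]: "norm (block_map p) = norm p"
proof (cases "p = 0")
  case False
  have "(norm (block_map p))\<^sup>2 * (norm p)\<^sup>2 = (norm p)\<^sup>2 * (norm p)\<^sup>2"
    using inner_block_map[of p p]
    by (simp add: power2_norm_eq_inner[symmetric] power2_eq_square[symmetric])
  then have "(norm (block_map p))\<^sup>2 = (norm p)\<^sup>2"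
    using False by (simp only: mult_cancel_right) simp
  then show ?thesis
    by simp
qed (simp add: block_map_def block_def zero_prod_def)

lemma inner_diff_block_map:
  "norm p * norm q * (p \<bullet> q - block_map p \<bullet> block_map q)
     = (norm p * norm q - p \<bullet> q) * (norm p * norm q + 2 * (p \<bullet> q))"
  using inner_block_map[of p q] by (simp add: power2_eq_square algebra_simps)

text \<open>Doubling an angle between 0 and pi/2 cannot increase its cosine.\<close>

lemma inner_block_map_le:
  assumes "p \<bullet> q \<ge> 0"
  shows "block_map p \<bullet> block_map q \<le> p \<bullet> q"
proof (cases "p = 0 \<or> q = 0")
  case False
  have "norm p * norm q * (p \<bullet> q - block_map p \<bullet> block_map q) \<ge> 0"
    unfolding inner_diff_block_map using assms norm_cauchy_schwarz[of p q]
    by (intro mult_nonneg_nonneg) auto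
  moreover have "norm p * norm q > 0"
    using False by simp
  ultimately show ?thesis
    by (simp only: zero_le_mult_iff) auto
qed (auto simp: block_map_def block_def zero_prod_def[symmetric])

lemma norm_diff_squared:
  fixes p q :: "'a::real_inner"
  shows "(norm (p - q))\<^sup>2 = (norm p)\<^sup>2 + (norm q)\<^sup>2 - 2 * (p \<bullet> q)"
  by (simp add: power2_norm_eq_inner inner_diff inner_commute)

lemma inner_block_map_ge:
  "p \<bullet> q - block_map p \<bullet> block_map q \<le> 3 / 2 * (norm (q - p))\<^sup>2"
proof (cases "p = 0 \<or> q = 0")
  case False
  then have pos: "norm p * norm q > 0"
    by simp
  have "norm p * norm q * (p \<bullet> q - block_map p \<bullet> block_map q)
      \<le> (norm p * norm q - p \<bullet> q) * (3 * (norm p * norm q))"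
    unfolding inner_diff_block_map using norm_cauchy_schwarz[of p q]
    by (intro mult_left_mono) auto
  then have "norm p * norm q * (p \<bullet> q - block_map p \<bullet> block_map q)
      \<le> norm p * norm q * (3 * (norm p * norm q - p \<bullet> q))"
    by (simp add: mult_ac)
  then have "p \<bullet> q - block_map p \<bullet> block_map q \<le> 3 * (norm p * norm q - p \<bullet> q)"
    using pos by (simp only: mult_le_cancel_left_pos)
  \<comment> \<open>The two sides differ by the square of \<open>norm q - norm p\<close>. With the
    factor 3 above, this yields the constant 3/2.\<close>
  moreover have "2 * (norm p * norm q - p \<bullet> q) \<le> (norm (q - p))\<^sup>2"
    using zero_le_power2[of "norm q - norm p"]
    by (simp add: norm_diff_squared power2_diff inner_commute mult_ac)
  ultimately show ?thesis
    by linarith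
qed (auto simp: block_map_def block_def zero_prod_def[symmetric])

lemma block_map_surj: "\<exists>q. block_map q = w"
proof (cases "w = 0")
  case True
  then show ?thesis
    by (intro exI[of _ 0]) (simp add: block_map_def block_def zero_prod_def)
next
  case False
  define v where "v = Complex (fst w) (snd w)"
  \<comment> \<open>The square root halves the argument, and the real factor restores the modulus of
    \<open>v\<close>; hence \<open>u\<^sup>2 / cmod u = v\<close>.\<close>
  define u where "u = csqrt v * sqrt (cmod v)"
  have "u\<^sup>2 = v * cmod v"
    by (simp add: u_def power_mult_distrib flip: of_real_power)
  have "v \<noteq> 0"
    using False by (auto simp: v_def complex_eq_iff prod_eq_iff)
  have "(cmod u)\<^sup>2 = (cmod v)\<^sup>2"
    unfolding norm_power[symmetric] \<open>u\<^sup>2 = _\<close> by (simp add: norm_mult norm_power power2_eq_square)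
  then have "cmod u = cmod v"
    by simp
  then have "sqrt ((Re u)\<^sup>2 + (Im u)\<^sup>2) = cmod v" "Re u \<noteq> 0 \<or> Im u \<noteq> 0"
    using \<open>v \<noteq> 0\<close> by (auto simp: cmod_def complex_eq_iff)
  moreover have "(Re u)\<^sup>2 - (Im u)\<^sup>2 = fst w * cmod v" "2 * Re u * Im u = snd w * cmod v"
    using arg_cong[OF \<open>u\<^sup>2 = _\<close>, of Re] arg_cong[OF \<open>u\<^sup>2 = _\<close>, of Im]
    by (simp_all add: v_def Re_power2 Im_power2)
  ultimately show ?thesis
    using \<open>v \<noteq> 0\<close> by (intro exI[of _ "(Re u, Im u)"]) (auto simp: block_map_def block_def)
qed

lemma block_map_minus: "block_map (- p) = block_map p"
  by (simp add: block_map_def block_def)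

text \<open>Preimages come in pairs \<open>q0\<close>, \<open>- q0\<close>, and one of them has
  nonnegative inner product with \<open>p\<close>. For that one, norm preservation turns
  \<open>inner_block_map_le\<close> into the distance bound.\<close>

lemma block_map_covering: "\<exists>q. block_map q = w \<and> norm (q - p) \<le> norm (w - block_map p)"
proof -
  obtain q0 where "block_map q0 = w"
    using block_map_surj by blast
  then have "block_map (- q0) = w"
    by (simp add: block_map_minus)
  moreover have "q0 \<bullet> p \<ge> 0 \<or> (- q0) \<bullet> p \<ge> 0"
    by (simp add: linear)
  ultimately obtain q where q: "block_map q = w" "q \<bullet> p \<ge> 0"
    using \<open>block_map q0 = w\<close> by blast
  have "(norm (q - p))\<^sup>2 \<le> (norm (block_map q - block_map p))\<^sup>2"
    using inner_block_map_le[OF q(2)] by (simp add: norm_diff_squared)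
  then have "norm (q - p) \<le> norm (block_map q - block_map p)"
    by (rule power2_le_imp_le) simp
  then show ?thesis
    using q(1) by blast
qed

section \<open>Passage to four dimensions as an orthogonal sum of two planes\<close>

definition fst_pair :: "real ^ 4 \<Rightarrow> real \<times> real" where
  "fst_pair x = (x $ 1, x $ 2)"

definition snd_pair :: "real ^ 4 \<Rightarrow> real \<times> real" where
  "snd_pair x = (x $ 3, x $ 4)"

lemma inner_pairs: "x \<bullet> y = fst_pair x \<bullet> fst_pair y + snd_pair x \<bullet> snd_pair y"
  by (simp add: inner_vec_def sum_4 fst_pair_def snd_pair_def)

lemma norm_pairs: "(norm x)\<^sup>2 = (norm (fst_pair x))\<^sup>2 + (norm (snd_pair x))\<^sup>2"
  by (simp add: power2_norm_eq_inner inner_pairs)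

lemma pair_diff:
  "fst_pair (x - y) = fst_pair x - fst_pair y" "snd_pair (x - y) = snd_pair x - snd_pair y"
  by (simp_all add: fst_pair_def snd_pair_def)

lemma pair_g_map:
  "fst_pair (g_map x) = block_map (fst_pair x)" "snd_pair (g_map x) = block_map (snd_pair x)"
  by (simp_all add: fst_pair_def snd_pair_def block_map_def g_map_nth)

lemma pair_eqI: "fst_pair x = fst_pair y \<Longrightarrow> snd_pair x = snd_pair y \<Longrightarrow> x = y"
  by (simp add: fst_pair_def snd_pair_def vec_eq_iff forall_4)

lemma ex_pairs: "\<exists>x. fst_pair x = p \<and> snd_pair x = q"
  by (rule exI[of _ "vector [fst p, snd p, fst q, snd q]"])
     (simp add: fst_pair_def snd_pair_def vector_def)

lemma norm_g_map: "norm (g_map x) = norm x"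
  by (rule power2_eq_imp_eq) (simp_all add: norm_pairs pair_g_map)

lemma inner_g_map_ge: "z \<bullet> u - g_map z \<bullet> g_map u \<le> 3 / 2 * (norm (u - z))\<^sup>2"
  using inner_block_map_ge[of "fst_pair z" "fst_pair u"]
    inner_block_map_ge[of "snd_pair z" "snd_pair u"]
  by (simp add: inner_pairs norm_pairs pair_diff pair_g_map)

lemma g_map_covering: "\<exists>u. g_map u = w \<and> norm (u - z) \<le> norm (w - g_map z)"
proof -
  obtain p q where
    p: "block_map p = fst_pair w" "norm (p - fst_pair z) \<le> norm (fst_pair w - block_map (fst_pair z))"
    and q: "block_map q = snd_pair w" "norm (q - snd_pair z) \<le> norm (snd_pair w - block_map (snd_pair z))"
    using block_map_covering by metis
  obtain u where u: "fst_pair u = p" "snd_pair u = q"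
    using ex_pairs by blast
  have "g_map u = w"
    by (rule pair_eqI) (simp_all add: pair_g_map u p q)
  \<comment> \<open>By Pythagoras the two planar bounds add up with no loss in the constant.\<close>
  moreover have "(norm (u - z))\<^sup>2 \<le> (norm (w - g_map z))\<^sup>2"
    unfolding norm_pairs pair_diff pair_g_map u using p(2) q(2)
    by (intro add_mono power_mono) auto
  then have "norm (u - z) \<le> norm (w - g_map z)"
    by (rule power2_le_imp_le) simp
  ultimately show ?thesis
    by blast
qed

text \<open>As \<open>g_map\<close> preserves norms, the terms \<open>z \<bullet> z\<close> and
  \<open>g_map z \<bullet> g_map z\<close> cancel in the numerator, and
  \<open>inner_g_map_ge\<close> supplies the quadratic bound.\<close>

lemma radial_mem_mordukhovich_derivative_g_map:
  assumes "z \<noteq> 0"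
  shows "z /\<^sub>R norm z \<in> mordukhovich_derivative g_map z (g_map z /\<^sub>R norm z)"
proof (rule mem_mordukhovich_derivative_quadratic)
  fix u
  have "(z /\<^sub>R norm z) \<bullet> (u - z) - (g_map z /\<^sub>R norm z) \<bullet> (g_map u - g_map z)
      = (z \<bullet> u - g_map z \<bullet> g_map u) / norm z"
    by (simp add: inner_diff_right power2_norm_eq_inner[symmetric] norm_g_map divide_simps)
  also have "\<dots> \<le> (3 / 2 * (norm (u - z))\<^sup>2) / norm z"
    by (intro divide_right_mono inner_g_map_ge) simp
  finally show "(z /\<^sub>R norm z) \<bullet> (u - z) - (g_map z /\<^sub>R norm z) \<bullet> (g_map u - g_map z)
      \<le> 3 / (2 * norm z) * (norm (u - z))\<^sup>2"
    by simp
qed simp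

theorem theorem5p14:
  fixes zbar :: "real ^ 4"
  assumes "zbar \<noteq> 0"
  shows "covering_constant g_map zbar (g_map zbar) = 1"
proof -
  have "Inf {ereal (norm x) | x y z.
      x \<in> mordukhovich_derivative g_map z y \<and>
      z \<in> cball zbar \<eta> \<and> g_map z \<in> cball (g_map zbar) \<eta> \<and> norm y = 1} = 1" (is "Inf ?S = 1")
    if "\<eta> > 0" for \<eta>
  proof (rule antisym)
    \<comment> \<open>The center \<open>zbar\<close> lies in every ball, so its radial pair of unit
      vectors serves for all radii.\<close>
    have "1 \<in> ?S"
      using assms that radial_mem_mordukhovich_derivative_g_map[OF assms]
      by (intro CollectI exI[of _ "zbar /\<^sub>R norm zbar"] exI[of _ "g_map zbar /\<^sub>R norm zbar"]
          exI[of _ zbar]) (simp add: norm_g_map one_ereal_def)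
    then show "Inf ?S \<le> 1"
      by (rule Inf_lower)
    show "1 \<le> Inf ?S"
    proof (rule Inf_greatest)
      fix s
      assume "s \<in> ?S"
      then obtain x y z where "s = ereal (norm x)" "norm y = 1"
        and x: "x \<in> mordukhovich_derivative g_map z y"
        by blast
      then show "1 \<le> s"
        using norm_le_of_mem_mordukhovich_derivative[OF g_map_covering x]
        by (simp add: one_ereal_def)
    qed
  qed
  \<comment> \<open>The infimum does not depend on the radius; the witness 1 only shows that there
    are positive radii.\<close>
  then show ?thesis
    unfolding covering_constant_def by (intro SUP_eq_const) (auto intro: exI[of _ 1])
qed

end
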